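(* Let $V_3\subset\mathbb{F}_3^4$ be a $3$-dimensional subspace such that the plane $\mathbb{P}V_3\subset\operatorname{PG}(3,3)$ contains exactly three of the four points $\langle1000\rangle,\langle0100\rangle,\langle0010\rangle,\langle0001\rangle$ (kind $\mathcal{C}_3$), let $H=\{A_\lambda:\lambda\in V_3\}$, and let $\mathcal{R}$ be any one of $\mathcal{R}_H,\mathcal{R}'_H,\mathcal{R}''_H$. Then the span $\langle\mathcal{R}\rangle$ is a $6$-dimensional projective subspace ($6$-flat, i.e. hyperplane) of $\operatorname{PG}(7,2)$.
   Context: Work over $\mathbb{F}_2$. $V_8=V(8,2)$ with basis $e_1,\dots,e_8$, $V_a=\langle e_1,e_8\rangle$, $V_b=\langle e_2,e_7\rangle$, $V_c=\langle e_3,e_6\rangle$, $V_d=\langle e_4,e_5\rangle$; points of $\operatorname{PG}(7,2)$ are nonzero vectors; $\omega_4$ is the set of vectors all four of whose components in $V_a,\dots,V_d$ are nonzero. Let $\zeta_a: e_1\mapsto e_8\mapsto e_1+e_8\mapsto e_1$, $\zeta_b: e_7\mapsto e_2\mapsto e_2+e_7\mapsto e_7$, $\zeta_c: e_3\mapsto e_6\mapsto e_3+e_6\mapsto e_3$, $\zeta_d: e_5\mapsto e_4\mapsto e_4+e_5\mapsto e_5$. For $\lambda=ijkl\in\mathbb{F}_3^4$ let $A_\lambda=\zeta_a^i\oplus\zeta_b^j\oplus\zeta_c^k\oplus\zeta_d^l$; these form a group $\mathcal{G}_{81}\cong(Z_3)^4$. Let $u=e_1+\dots+e_8$. For a subgroup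 $H\cong(Z_3)^3$ of $\mathcal{G}_{81}$ with cosets $H,H',H''$, set $\mathcal{R}_H=\{hu:h\in H\}$, $\mathcal{R}'_H=\{hu:h\in H'\}$, $\mathcal{R}''_H=\{hu:h\in H''\}$ (27-subsets of $\omega_4$). *)

theory Defs
  imports "HOL-Analysis.Analysis" "HOL-Library.Z2" "HOL-Algebra.Coset"
    "Berlekamp_Zassenhaus.Finite_Field"
begin

(* Enum.finite_3 only supplies the cardinality: finite_3 mod_ring is Z/3Z. *)
lemma CARD_finite_3: "CARD(Enum.finite_3) = 3"
  by (simp add: card_UNIV_length_enum enum_finite_3_def)

instance Enum.finite_3 :: prime_card
  by standard (simp only: CARD_finite_3, simp)

type_synonym gf3 = "Enum.finite_3 mod_ring"

(* The coordinates of V(8,2) and of (F_3)^4 are indexed by the numeral types 8 and 4, whose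
   elements are residues: the index 8 :: 8 equals 0 and 4 :: 4 equals 0, and 1, ..., n are the
   n distinct elements of the type n. *)
type_synonym V8 = "bit ^ 8"

definition e :: "8 \<Rightarrow> V8" where
  "e i = axis i 1"

definition u :: V8 where
  "u = (\<Sum>i\<in>UNIV. e i)"

(* The projection of V(8,2) onto its direct summand spanned by e p and e q. *)
definition plane_proj :: "8 \<Rightarrow> 8 \<Rightarrow> V8 \<Rightarrow> V8" where
  "plane_proj p q x = x $ p *s e p + x $ q *s e q"

(* The linear map on the span of e p and e q given by  e p |-> e q |-> e p + e q |-> e p,
   extended by 0 on the other basis vectors. *)
definition zeta :: "8 \<Rightarrow> 8 \<Rightarrow> V8 \<Rightarrow> V8" where
  "zeta p q x = x $ p *s e q + x $ q *s (e p + e q)"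

lemma zeta_basis:
  assumes "p \<noteq> q"
  shows "zeta p q (e p) = e q" "zeta p q (e q) = e p + e q" "zeta p q (e p + e q) = e p"
  using assms by (auto simp: zeta_def e_def axis_def vec_eq_iff)

definition zeta_pow :: "8 \<Rightarrow> 8 \<Rightarrow> gf3 \<Rightarrow> V8 \<Rightarrow> V8" where
  "zeta_pow p q i = zeta p q ^^ nat (to_int_mod_ring i)"

(* The direct sum of powers of the four maps of order 3: each power acts on the component
   of x in its own summand. *)
definition A :: "gf3 ^ 4 \<Rightarrow> V8 \<Rightarrow> V8" where
  "A l x = zeta_pow 1 8 (l $ 1) (plane_proj 1 8 x) + zeta_pow 7 2 (l $ 2) (plane_proj 7 2 x)
         + zeta_pow 3 6 (l $ 3) (plane_proj 3 6 x) + zeta_pow 5 4 (l $ 4) (plane_proj 5 4 x)"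

definition G81 :: "(V8 \<Rightarrow> V8) monoid" where
  "G81 = \<lparr>carrier = range A, mult = (\<circ>), one = id\<rparr>"

definition points_of :: "('a::field ^ 'n) set \<Rightarrow> ('a ^ 'n) set set" where
  "points_of V = {P. vec.subspace P \<and> vec.dim P = 1 \<and> P \<subseteq> V}"

definition coordinate_points :: "('a::field ^ 'n) set set" where
  "coordinate_points = (\<lambda>i. vec.span {axis i 1}) ` UNIV"

(* Over F_2 every projective point is represented by a unique nonzero vector, so flats of
   PG(n-1,2) are sets of nonzero vectors; d is the projective dimension. *)
definition is_flat :: "nat \<Rightarrow> (bit ^ 'n) set \<Rightarrow> bool" where
  "is_flat d F \<longleftrightarrow> (\<exists>W. vec.subspace W \<and> vec.dim W = d + 1 \<and> F = W - {0})"

definition proj_span :: "(bit ^ 'n) set \<Rightarrow> (bit ^ 'n) set" where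
  "proj_span S = vec.span S - {0}"

end

theory Submission
  imports Defs
begin

text \<open>
  A three-dimensional \<open>V3\<close> containing exactly three coordinate points is a coordinate hyperplane
  \<open>l $ k = 0\<close>, so a coset of \<open>H\<close> consists of the \<open>A l\<close> with \<open>l $ k\<close> constant. In the \<open>k\<close>-th of the
  four planes the vectors of \<open>R\<close> thus have a fixed nonzero component \<open>w\<close>, while the other components
  range independently over all nonzero vectors. The three nonzero vectors of a plane sum to zero, so
  differences of vectors of \<open>R\<close> yield the three other planes entirely, and then \<open>w\<close> itself. Hence the
  span of \<open>R\<close> has codimension one: adding one more vector of the \<open>k\<close>-th plane yields the whole space.
\<close>

section \<open>Residues: the indices of type \<open>8\<close> and the field
  \<open>gf3\<close>\<close>

lemma exhaust_8:
  fixes j :: 8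
  shows "j = 1 \<or> j = 2 \<or> j = 3 \<or> j = 4 \<or> j = 5 \<or> j = 6 \<or> j = 7 \<or> j = 8"
proof (induct j)
  case (of_int z)
  then have "z = 0 \<or> z = 1 \<or> z = 2 \<or> z = 3 \<or> z = 4 \<or> z = 5 \<or> z = 6 \<or> z = 7"
    by auto
  then show ?case by auto
qed

lemma to_int_mod_ring_gf3_2: "to_int_mod_ring (2 :: gf3) = 2"
  using to_int_mod_ring_add[of "1 :: gf3" 1] by (simp add: CARD_finite_3)

lemma three_eq_0_gf3: "(3 :: gf3) = 0"
  using of_nat_card_eq_0[where 'a = Enum.finite_3] by (simp add: CARD_finite_3)

lemma four_eq_1_gf3: "(4 :: gf3) = 1"
proof -
  have "(4 :: gf3) = 3 + 1" by simp
  then show ?thesis by (simp only: three_eq_0_gf3 add_0_left)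
qed

lemma exhaust_gf3:
  fixes c :: gf3
  shows "c = 0 \<or> c = 1 \<or> c = 2"
proof -
  have "to_int_mod_ring c \<in> {0..<3}"
    using range_to_int_mod_ring[where 'a = Enum.finite_3] by (auto simp: CARD_finite_3)
  then have "to_int_mod_ring c = 0 \<or> to_int_mod_ring c = 1 \<or> to_int_mod_ring c = 2"
    unfolding atLeastLessThan_iff by presburger
  \<comment> \<open>The goal compares integer values, so the simp rules that would turn
    \<open>to_int_mod_ring c = 0\<close> into \<open>c = 0\<close> (likewise for 1) are
    removed.\<close>
  then have "to_int_mod_ring c \<in> to_int_mod_ring ` {0, 1, 2 :: gf3}"
    by (simp add: to_int_mod_ring_gf3_2
        del: to_int_mod_ring_hom.hom_0_iff to_int_mod_ring_hom.hom_1_iff)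
  then show ?thesis
    by (metis (no_types, lifting) imageE insertE of_int_mod_ring_to_int_mod_ring singletonD)
qed

lemma nat_to_int_mod_ring_add:
  fixes a b :: gf3
  shows "nat (to_int_mod_ring (a + b)) = (nat (to_int_mod_ring a) + nat (to_int_mod_ring b)) mod 3"
proof -
  have "to_int_mod_ring a \<ge> 0" "to_int_mod_ring b \<ge> 0"
    using range_to_int_mod_ring[where 'a = Enum.finite_3] by fastforce+
  then show ?thesis
    by (simp add: to_int_mod_ring_add CARD_finite_3 nat_add_distrib nat_mod_distrib)
qed

section \<open>The nonzero vectors of the four planes\<close>

lemma add_self_V8: "v + v = 0" for v :: V8
  by (simp add: vec_eq_iff)

text \<open>The order within each pair is the one in which the maps of the definition of \<open>A\<close> take it.\<close>

definition fst_index :: "4 \<Rightarrow> 8" where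
  "fst_index i = (if i = 1 then 1 else if i = 2 then 7 else if i = 3 then 3 else 5)"

definition snd_index :: "4 \<Rightarrow> 8" where
  "snd_index i = (if i = 1 then 8 else if i = 2 then 2 else if i = 3 then 6 else 4)"

text \<open>Labels the nonzero vectors of a plane by F_3 so that powers of \<open>zeta\<close> act
  as translations of the label. The component of \<open>u\<close> serves as origin.\<close>

definition plane_vec :: "4 \<Rightarrow> gf3 \<Rightarrow> V8" where
  "plane_vec i c = zeta_pow (fst_index i) (snd_index i) c (e (fst_index i) + e (snd_index i))"

definition component :: "4 \<Rightarrow> V8 \<Rightarrow> V8" where
  "component i = plane_proj (fst_index i) (snd_index i)"

lemma fst_index_neq_snd_index: "fst_index i \<noteq> snd_index j"
  using exhaust_4[of i] exhaust_4[of j] by (auto simp: fst_index_def snd_index_def)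

lemma fst_index_eq_iff: "fst_index i = fst_index j \<longleftrightarrow> i = j"
  using exhaust_4[of i] exhaust_4[of j] by (auto simp: fst_index_def)

lemma snd_index_eq_iff: "snd_index i = snd_index j \<longleftrightarrow> i = j"
  using exhaust_4[of i] exhaust_4[of j] by (auto simp: snd_index_def)

lemma index_cases: "\<exists>i. j = fst_index i \<or> j = snd_index i"
  using exhaust_8[of j]
  by (elim disjE; simp only: fst_index_def snd_index_def)
     (rule exI[of _ 1] exI[of _ 2] exI[of _ 3] exI[of _ 4], simp; fail)+

lemma plane_vec_simps:
  "plane_vec i 0 = e (fst_index i) + e (snd_index i)"
  "plane_vec i 1 = e (fst_index i)"
  "plane_vec i 2 = e (snd_index i)"
  using fst_index_neq_snd_index[of i i]
  by (simp_all add: plane_vec_def zeta_pow_def zeta_basis to_int_mod_ring_gf3_2 numeral_2_eq_2)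

text \<open>Iterates add their exponents as natural numbers, labels add modulo 3; the two agree
  because the third iterate of \<open>zeta\<close> fixes the starting vector.\<close>

lemma zeta_pow_plane_vec:
  "zeta_pow (fst_index i) (snd_index i) a (plane_vec i b) = plane_vec i (a + b)"
proof -
  have "(zeta (fst_index i) (snd_index i) ^^ 3) (e (fst_index i) + e (snd_index i))
      = e (fst_index i) + e (snd_index i)"
    using fst_index_neq_snd_index[of i i] by (simp add: numeral_3_eq_3 zeta_basis)
  from funpow_mod_eq[OF this] show ?thesis
    by (simp add: plane_vec_def zeta_pow_def nat_to_int_mod_ring_add funpow_add)
qed

lemma plane_vec_nonzero: "plane_vec i c \<noteq> 0"
  using exhaust_gf3[of c] fst_index_neq_snd_index[of i i]
  by (auto simp: plane_vec_simps e_def axis_def vec_eq_iff)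

lemma plane_vec_add: "plane_vec i (c + 1) + plane_vec i (c + 2) = plane_vec i c"
proof -
  have "(1 :: gf3) + 2 = 0" "(2 :: gf3) + 2 = 1" "(2 :: gf3) + 1 = 0" "(1 :: gf3) + 1 = 2"
    by (simp_all add: three_eq_0_gf3 four_eq_1_gf3)
  then show ?thesis
    using exhaust_gf3[of c] add_self_V8[of "e (fst_index i)"] add_self_V8[of "e (snd_index i)"]
    by (auto simp: plane_vec_simps algebra_simps)
qed

lemma e_eq_plane_vec: "\<exists>i c. e j = plane_vec i c"
  using index_cases[of j] plane_vec_simps by metis

lemma linear_component: "Vector_Spaces.linear (*s) (*s) (component i)"
  by unfold_locales
     (simp_all only: component_def plane_proj_def vector_add_component vector_smult_component
       vector_add_ldistrib vector_sadd_rdistrib vector_smult_assoc add_ac)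

lemma component_plane_vec: "component i (plane_vec j c) = (if i = j then plane_vec j c else 0)"
  using exhaust_gf3[of c] fst_index_neq_snd_index fst_index_neq_snd_index[symmetric]
  by (auto simp: component_def plane_vec_simps plane_proj_def e_def axis_def vec_eq_iff
      fst_index_eq_iff snd_index_eq_iff)

section \<open>The orbit of \<open>u\<close>, labelled by F_3^4\<close>

definition orbit_vec :: "gf3 ^ 4 \<Rightarrow> V8" where
  "orbit_vec l = (\<Sum>i\<in>UNIV. plane_vec i (l $ i))"

lemma component_orbit_vec: "component i (orbit_vec l) = plane_vec i (l $ i)"
  by (simp add: orbit_vec_def vec.linear_sum[OF linear_component] component_plane_vec)

lemma A_eq: "A l y = (\<Sum>i\<in>UNIV. zeta_pow (fst_index i) (snd_index i) (l $ i) (component i y))"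
  by (simp add: sum_4 A_def component_def fst_index_def snd_index_def)

text \<open>Each plane contributes one translation, so the group acts on labels by translation; this
  turns cosets of \<open>H\<close> into translates of \<open>V3\<close>.\<close>

lemma A_orbit_vec: "A l (orbit_vec m) = orbit_vec (l + m)"
  by (simp add: A_eq component_orbit_vec zeta_pow_plane_vec) (simp add: orbit_vec_def)

lemma orbit_vec_0: "orbit_vec 0 = u"
proof -
  have "(UNIV :: 8 set) = range fst_index \<union> range snd_index"
    using index_cases by blast
  then have "u = (\<Sum>j\<in>range fst_index \<union> range snd_index. e j)"
    by (simp only: u_def)
  also have "\<dots> = (\<Sum>j\<in>range fst_index. e j) + (\<Sum>j\<in>range snd_index. e j)"
    using fst_index_neq_snd_index by (intro sum.union_disjoint) auto
  also have "\<dots> = (\<Sum>i\<in>UNIV. e (fst_index i)) + (\<Sum>i\<in>UNIV. e (snd_index i))"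
    by (simp add: sum.reindex inj_def fst_index_eq_iff snd_index_eq_iff)
  also have "\<dots> = orbit_vec 0"
    by (simp add: orbit_vec_def plane_vec_simps sum.distrib)
  finally show ?thesis ..
qed

section \<open>The span of a coset orbit\<close>

lemma span_axis: "vec.span (range (\<lambda>i. axis i 1)) = (UNIV :: ('a :: field ^ 'n) set)"
  using span_cart_basis by (simp add: cart_basis_def full_SetCompr_eq)

lemma dim_span_orbit_vecs:
  fixes k :: 4 and c :: gf3
  defines "S \<equiv> orbit_vec ` {l. l $ k = c}"
  shows "vec.dim (vec.span S) = 7"
proof -
  have orbit_vec_in: "orbit_vec l \<in> vec.span S" if "l $ k = c" for l
    using that by (auto simp: S_def intro: vec.span_base)
  have pair_in: "plane_vec i a + plane_vec i b \<in> vec.span S" if "i \<noteq> k" for i a b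
  proof -
    \<comment> \<open>Two such labels differ only at \<open>i\<close>, so all other summands cancel
      in the difference. Since \<open>i \<noteq> k\<close>, their \<open>k\<close>-th entry is
      \<open>c\<close>, as membership in \<open>S\<close> demands.\<close>
    let ?l = "\<lambda>a. \<chi> j. if j = i then a else c"
    have orbit_vec_l: "orbit_vec (?l a) = plane_vec i a + (\<Sum>j\<in>UNIV - {i}. plane_vec j c)" for a
      by (simp add: orbit_vec_def sum.remove[of _ i])
    have "orbit_vec (?l a) - orbit_vec (?l b) \<in> vec.span S"
      using that by (intro vec.span_diff orbit_vec_in) auto
    moreover have "plane_vec i a - plane_vec i b = plane_vec i a + plane_vec i b"
      by (simp add: diff_eq_eq add.assoc add_self_V8)
    ultimately show ?thesis by (simp add: orbit_vec_l)
  qed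
  have other_in: "plane_vec i d \<in> vec.span S" if "i \<noteq> k" for i d
    using pair_in[OF that, of "d + 1" "d + 2"] by (simp add: plane_vec_add)
  have "orbit_vec (\<chi> j. c) - (\<Sum>j\<in>UNIV - {k}. plane_vec j c) \<in> vec.span S"
    by (intro vec.span_diff orbit_vec_in vec.span_sum other_in) auto
  then have k_in: "plane_vec k c \<in> vec.span S"
    by (simp add: orbit_vec_def sum.remove[of _ k])
  let ?T = "insert (plane_vec k (c + 1)) S"
  have S_T: "vec.span S \<subseteq> vec.span ?T"
    by (rule vec.span_mono) auto
  have k1_in: "plane_vec k (c + 1) \<in> vec.span ?T"
    by (rule vec.span_base) simp
  have "c + 2 + 1 = c" "c + 2 + 2 = c + 1"
    by (simp_all add: add.assoc three_eq_0_gf3 four_eq_1_gf3)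
  then have "plane_vec k (c + 2) = plane_vec k c + plane_vec k (c + 1)"
    using plane_vec_add[of k "c + 2"] by (simp only:)
  then have k2_in: "plane_vec k (c + 2) \<in> vec.span ?T"
    using k_in k1_in S_T by (auto intro: vec.span_add)
  have "plane_vec i d \<in> vec.span ?T" for i d
    using exhaust_gf3[of "d - c"] other_in[of i d] k_in k1_in k2_in S_T
    by (cases "i = k") (auto simp: diff_eq_eq add.commute)
  then have "e j \<in> vec.span ?T" for j
    using e_eq_plane_vec[of j] by auto
  then have "vec.span (range (\<lambda>i. axis i 1)) \<subseteq> vec.span ?T"
    by (intro vec.span_minimal) (auto simp: e_def)
  then have "vec.span ?T = UNIV"
    by (simp add: span_axis top.extremum_unique)
  then have dim_T: "vec.dim ?T = 8"
    using vec.dim_span[of ?T] by (simp add: vec_dim_card del: vec.dim_UNIV)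
  \<comment> \<open>All generators have the same \<open>k\<close>-th component
    \<open>plane_vec k c\<close>, so the span lies in the preimage under \<open>component k\<close>
    of the line it generates, which the added vector avoids.\<close>
  have "vec.span S \<subseteq> {y. component k y \<in> vec.span {plane_vec k c}}"
    by (intro vec.span_minimal vec.linear_subspace_linear_preimage linear_component vec.subspace_span)
       (auto simp: S_def component_orbit_vec intro: vec.span_base)
  moreover have "component k (plane_vec k (c + 1)) \<notin> vec.span {plane_vec k c}"
  proof
    assume "component k (plane_vec k (c + 1)) \<in> vec.span {plane_vec k c}"
    then obtain t where t: "plane_vec k (c + 1) = t *s plane_vec k c"
      by (auto simp: component_plane_vec vec.span_singleton)
    show False
    proof (cases t)
      case zero
      with t show False by (simp add: plane_vec_nonzero)
    next
      case one
      \<comment> \<open>With \<open>t = 1\<close> two of the three vectors would coincide, forcing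
        the third, \<open>plane_vec k (c + 2)\<close>, to vanish.\<close>
      with t plane_vec_add[of k c] show False by (simp add: plane_vec_nonzero)
    qed
  qed
  ultimately have "plane_vec k (c + 1) \<notin> vec.span S" by auto
  with dim_T show ?thesis
    by (simp add: vec.dim_insert)
qed

section \<open>Hyperplanes through three coordinate points\<close>

lemma subspace_missing_one_axis:
  fixes V :: "('a :: field ^ 'n) set"
  assumes "vec.subspace V" "\<And>i. axis i 1 \<in> V \<longleftrightarrow> i \<noteq> k"
  shows "V = {v. v $ k = 0}"
proof -
  \<comment> \<open>Clearing the \<open>k\<close>-th coordinate leaves a combination of axes in
    \<open>V\<close>. Hence \<open>v \<in> V\<close> depends only on whether
    \<open>v $ k *s axis k 1\<close> lies in \<open>V\<close>, that is, on
    \<open>v $ k = 0\<close>.\<close>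
  have decomp: "v - v $ k *s axis k 1 \<in> V" for v :: "'a ^ 'n"
  proof -
    have "v = (\<Sum>i\<in>UNIV. v $ i *s axis i 1)"
      by (simp add: basis_expansion)
    also have "\<dots> = v $ k *s axis k 1 + (\<Sum>i\<in>UNIV - {k}. v $ i *s axis i 1)"
      by (simp add: sum.remove[of _ k])
    finally have "v - v $ k *s axis k 1 = (\<Sum>i\<in>UNIV - {k}. v $ i *s axis i 1)"
      by (simp add: algebra_simps)
    also have "\<dots> \<in> V"
      using assms by (intro vec.subspace_sum vec.subspace_scale) auto
    finally show ?thesis .
  qed
  show ?thesis
  proof (intro equalityI subsetI CollectI)
    fix v assume "v \<in> V"
    then have "v $ k *s axis k 1 \<in> V"
      using vec.subspace_diff[OF assms(1) _ decomp[of v], of v] by simp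
    then have "inverse (v $ k) *s (v $ k *s axis k 1) \<in> V"
      by (rule vec.subspace_scale[OF assms(1)])
    then show "v $ k = 0"
      using assms(2)[of k] by (cases "v $ k = 0") (auto simp: vector_smult_assoc)
  next
    fix v :: "'a ^ 'n" assume "v \<in> {v. v $ k = 0}"
    with decomp[of v] show "v \<in> V" by simp
  qed
qed

text \<open>Three coordinate points require at least three axis vectors in \<open>V\<close>, while
  all four would span the whole space, against dimension 3. So exactly one axis is missing.\<close>

lemma hyperplane_through_three_coordinate_points:
  fixes V :: "(gf3 ^ 4) set"
  assumes V: "vec.subspace V" and dim: "vec.dim V = 3"
    and three: "card (points_of V \<inter> coordinate_points) = 3"
  shows "\<exists>k. V = {l. l $ k = 0}"
proof -
  define I where "I = {i. axis i 1 \<in> V}"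
  have "points_of V \<inter> coordinate_points \<subseteq> (\<lambda>i. vec.span {axis i 1}) ` I"
    by (auto simp: points_of_def coordinate_points_def I_def intro: vec.span_base)
  then have "3 \<le> card ((\<lambda>i. vec.span {axis i (1 :: gf3)}) ` I)"
    using three by (metis card_mono finite)
  then have "3 \<le> card I"
    by (meson card_image_le finite le_trans)
  moreover have "I \<noteq> UNIV"
  proof
    assume "I = UNIV"
    then have "vec.span (range (\<lambda>i. axis i 1)) \<subseteq> V"
      using V by (intro vec.span_minimal) (auto simp: I_def)
    then have "V = UNIV" by (simp add: span_axis top.extremum_unique)
    with dim show False by (simp add: vec_dim_card del: vec.dim_UNIV)
  qed
  moreover have "card (- I) = 4 - card I"
    using card_Diff_subset[of I UNIV] by (simp flip: Compl_eq_Diff_UNIV)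
  moreover have "card (- I) \<noteq> 0" using \<open>I \<noteq> UNIV\<close> by auto
  ultimately have "card (- I) = 1" by linarith
  then obtain k where "- I = {k}" by (auto simp: card_1_singleton_iff)
  then have "axis i 1 \<in> V \<longleftrightarrow> i \<noteq> k" for i by (auto simp: I_def)
  from subspace_missing_one_axis[OF V this] show ?thesis ..
qed

theorem theorem8:
  fixes V3 :: "(gf3 ^ 4) set"
    and H K :: "(V8 \<Rightarrow> V8) set"
    and R :: "V8 set"
  assumes "vec.subspace V3" and "vec.dim V3 = 3"
    and "card (points_of V3 \<inter> coordinate_points) = 3"
    and "H = A ` V3"
    and "K \<in> rcosets\<^bsub>G81\<^esub> H"
    and "R = {h u | h. h \<in> K}"
  shows "is_flat 6 (proj_span R)"
proof -
  obtain k where k: "V3 = {l. l $ k = 0}"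
    using hyperplane_through_three_coordinate_points assms by blast
  \<comment> \<open>Any representative of the coset is some \<open>A m\<close>, since the carrier is
    \<open>range A\<close>; this treats all three cosets at once.\<close>
  obtain m where "K = (\<lambda>l. A l \<circ> A m) ` V3"
    using assms(4,5) by (auto simp: RCOSETS_def r_coset_def G81_def)
  moreover have "R = (\<lambda>h. h u) ` K"
    using assms(6) by auto
  ultimately have "R = (\<lambda>l. orbit_vec (l + m)) ` V3"
    by (simp add: image_image A_orbit_vec flip: orbit_vec_0)
  also have "\<dots> = orbit_vec ` {l. l $ k = m $ k}"
    unfolding k image_image[of orbit_vec "\<lambda>l. l + m", symmetric]
    \<comment> \<open>A label with \<open>k\<close>-th entry \<open>m $ k\<close> is reached from
      its translate by \<open>- m\<close>, whose \<open>k\<close>-th entry is 0.\<close>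
    by (rule arg_cong[where f = "image orbit_vec"]) (force intro: image_eqI[of _ _ "_ - m"])
  finally show ?thesis
    unfolding is_flat_def proj_span_def using dim_span_orbit_vecs[of k "m $ k"] by auto
qed

end
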